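(* Let $\pi_0 = \pi(x_0)$ be the initial CP-feasible point for Algorithm 1, and assume $0 < \epsilon < \frac{c \cdot \pi_0 - z^*}{c \cdot e - z^*}$. Then for the points $\pi_k$ generated by Algorithm 1, $$\ell \geq (2M\,\mathrm{Dist}_{c \cdot \pi_0})^2 \left( \frac{4}{3}\left(\frac{1-\epsilon}{\epsilon}\right)^2 + 4\left(\frac{1-\epsilon}{\epsilon}\right) + \log_2\left(\frac{\frac{c \cdot \pi_0 - z^*}{c \cdot e - z^*}}{\epsilon}\right) + \log_2\left(\frac{1-\epsilon}{1 - \frac{c \cdot \pi_0 - z^*}{c \cdot e - z^*}}\right) + 1 \right)$$ implies $$\min_{k \leq \ell} \frac{c \cdot \pi_k - z^*}{c \cdot e - z^*} \leq \epsilon .$$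
   Context: $\mathcal{E}$ is a finite-dimensional real Euclidean space with inner product written $u \cdot v$, and $\mathcal{K} \subset \mathcal{E}$ is a proper (meaning $\mathcal{K} \neq \mathcal{E}$; not necessarily pointed) closed convex cone with nonempty interior $\mathrm{int}(\mathcal{K})$. $\mathrm{Affine} \subseteq \mathcal{E}$ is an affine space (a translate of a linear subspace), and $c \in \mathcal{E}$ is not orthogonal to the subspace of which $\mathrm{Affine}$ is a translate. The conic program CP is $$\min\ c \cdot x \quad \text{s.t.} \quad x \in \mathrm{Affine},\ x \in \mathcal{K};$$ it is assumed to have an optimal solution, and $z^*$ denotes its optimal value. The set $\mathrm{Affine} \cap \mathrm{int}(\mathcal{K})$ is assumed nonempty, and $e$ is a fixed point of it. For $z \in \mathbb{R}$, $\mathrm{Affine}_z := \{x \in \mathrm{Affine} : c \cdot x = z\}$; all the nonempty sets $\mathrm{Affine}_z$ are translates of one linear subspace $\mathcal{L}$. For $x \in \mathcal{E}$, $$\lambda_{\min}(x) := \inf\{\lambda \in \mathbb{R} : x - \lambda e \notin \mathcal{K}\},$$ a concave function; it is the unique scalar $\lambda$ for which $x - \lambda e$ lies in the boundary of $\mathcal{K}$. For $x$ with $\lambda_{\min}(x) < 1$ (which holds for every $x \in \mathrm{Affine}$ with $c \cdot x < c \cdot e$), $\pi(x) := e + \frac{1}{1-\lambda_{\min}(x)}(x-e)$. A "computational" inner product $\langle\,,\,\rangle$ on $\mathcal{E}$, possibly different from $u \cdot v$, is fixed, with norm $\|\ \|$. A supgradient of $\lambda_{\min}$ at $x$ is a vector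 $\nabla\lambda_{\min}(x) \in \mathcal{E}$ with $\lambda_{\min}(x) + \langle \nabla\lambda_{\min}(x), v\rangle \geq \lambda_{\min}(x+v)$ for all $v \in \mathcal{E}$; projection onto $\mathcal{L}$ means orthogonal projection with respect to $\langle\,,\,\rangle$. $M$ is the Lipschitz constant $\sup\{|\lambda_{\min}(x) - \lambda_{\min}(y)|/\|x-y\| : x,y \in \mathrm{Affine}_z,\ x \neq y\}$ of $\lambda_{\min}$ restricted to $\mathrm{Affine}_z$, which is finite and independent of $z$ ($M := 0$ if $\mathcal{L} = \{0\}$). For $z < c \cdot e$ and $x \in \mathrm{Affine}_z$, $$\mathrm{dist}_z(x) := \min\{\|x - x_z^*\| : x_z^* \text{ maximizes } \lambda_{\min} \text{ over } \mathrm{Affine}_z\}$$ (the set of maximizers is nonempty). For $z \in \mathbb{R}$, $\mathrm{Level}_z := \mathrm{Affine}_z \cap \mathcal{K}$. For $z^* \leq z < c \cdot e$, $$\mathrm{Dist}_z := \sup\{\mathrm{dist}_{z'}(x) : z' \leq z \text{ and } x \in \mathrm{Level}_{z'}\} \in [0,+\infty].$$ Algorithm 1. Input: $z^*$; $e$; and $\bar{x} \in \mathrm{Affine}$ with $c \cdot \bar{x} < c \cdot e$. Initialize $x_0 = e + \frac{c \cdot e - z^*}{c \cdot e - c \cdot \bar{x}}(\bar{x} - e)$ (so $c \cdot x_0 = z^*$) and $\pi_0 = \pi(x_0)$. For $k = 0,1,2,\ldots$: $$x_{k+1} = x_k - \frac{\lambda_{\min}(x_k)}{\|g_k\|^2}\,g_k,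 \qquad \pi_{k+1} = \pi(x_{k+1}),$$ where $g_k$ is the projection onto $\mathcal{L}$ of a supgradient $\nabla\lambda_{\min}(x_k)$ (any choice). If $g_k = 0$ (in which case $x_k$ is optimal for CP), the step is taken to be zero, i.e. $x_{k+1} = x_k$. The index $\ell$ is a nonnegative integer. *)

theory Defs
  imports "HOL-Analysis.Analysis"
begin

text \<open>
  The inner product of the Euclidean space is the one of the type class.  The computational
  inner product is a function \<open>ip\<close>, with norm \<open>ip_norm ip\<close>.
\<close>

definition is_inner_product :: "('a::real_vector \<Rightarrow> 'a \<Rightarrow> real) \<Rightarrow> bool" where
  "is_inner_product ip \<longleftrightarrow>
     bilinear ip \<and> (\<forall>u v. ip u v = ip v u) \<and> (\<forall>u. u \<noteq> 0 \<longrightarrow> 0 < ip u u)"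

definition ip_norm :: "('a \<Rightarrow> 'a \<Rightarrow> real) \<Rightarrow> 'a \<Rightarrow> real" where
  "ip_norm ip u = sqrt (ip u u)"

definition is_orth_projection ::
  "('a::real_vector \<Rightarrow> 'a \<Rightarrow> real) \<Rightarrow> 'a set \<Rightarrow> 'a \<Rightarrow> 'a \<Rightarrow> bool" where
  "is_orth_projection ip L u w \<longleftrightarrow> w \<in> L \<and> (\<forall>v\<in>L. ip (u - w) v = 0)"

definition is_supgradient ::
  "('a::real_vector \<Rightarrow> 'a \<Rightarrow> real) \<Rightarrow> ('a \<Rightarrow> real) \<Rightarrow> 'a \<Rightarrow> 'a \<Rightarrow> bool" where
  "is_supgradient ip f x s \<longleftrightarrow> (\<forall>v. f x + ip s v \<ge> f (x + v))"

text \<open>For a nonempty affine set, the linear subspace of which it is a translate.\<close>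

definition direction :: "'a::real_vector set \<Rightarrow> 'a set" where
  "direction A = {x - y |x y. x \<in> A \<and> y \<in> A}"

definition optimal_solution :: "'a::real_inner set \<Rightarrow> 'a set \<Rightarrow> 'a \<Rightarrow> 'a \<Rightarrow> bool" where
  "optimal_solution K A c x \<longleftrightarrow> x \<in> A \<inter> K \<and> (\<forall>y\<in>A \<inter> K. c \<bullet> x \<le> c \<bullet> y)"

definition optimal_value :: "'a::real_inner set \<Rightarrow> 'a set \<Rightarrow> 'a \<Rightarrow> real" where
  "optimal_value K A c = (INF x\<in>A \<inter> K. c \<bullet> x)"

definition affine_slice :: "'a::real_inner set \<Rightarrow> 'a \<Rightarrow> real \<Rightarrow> 'a set" where
  "affine_slice A c z = {x \<in> A. c \<bullet> x = z}"

definition level :: "'a::real_inner set \<Rightarrow> 'a set \<Rightarrow> 'a \<Rightarrow> real \<Rightarrow> 'a set" where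
  "level K A c z = affine_slice A c z \<inter> K"

text \<open>
  The subspace \<open>\<L>\<close>.  All nonempty slices have the same direction, so the union is that
  common direction.
\<close>

definition slice_space :: "'a::real_inner set \<Rightarrow> 'a \<Rightarrow> 'a set" where
  "slice_space A c = (\<Union>z. direction (affine_slice A c z))"

definition lambda_min :: "'a::real_vector set \<Rightarrow> 'a \<Rightarrow> 'a \<Rightarrow> real" where
  "lambda_min K e x = Inf {l. x - l *\<^sub>R e \<notin> K}"

text \<open>Only meaningful where \<open>lambda_min K e x < 1\<close>.\<close>

definition radial_proj :: "'a::real_vector set \<Rightarrow> 'a \<Rightarrow> 'a \<Rightarrow> 'a" where
  "radial_proj K e x = e + (1 / (1 - lambda_min K e x)) *\<^sub>R (x - e)"

definition lipschitz_const ::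
  "('a \<Rightarrow> 'a \<Rightarrow> real) \<Rightarrow> 'a set \<Rightarrow> 'a::real_inner set \<Rightarrow> 'a \<Rightarrow> 'a \<Rightarrow> real \<Rightarrow> real" where
  "lipschitz_const ip K A c e z =
     (if slice_space A c = {0} then 0
      else Sup {\<bar>lambda_min K e x - lambda_min K e y\<bar> / ip_norm ip (x - y) |x y.
                  x \<in> affine_slice A c z \<and> y \<in> affine_slice A c z \<and> x \<noteq> y})"

definition slice_maximizers ::
  "'a::real_inner set \<Rightarrow> 'a set \<Rightarrow> 'a \<Rightarrow> 'a \<Rightarrow> real \<Rightarrow> 'a set" where
  "slice_maximizers K A c e z =
     {y \<in> affine_slice A c z. \<forall>x\<in>affine_slice A c z. lambda_min K e x \<le> lambda_min K e y}"

text \<open>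
  For \<open>z < c \<bullet> e\<close> the set of maximizers is nonempty and closed, so the infimum in
  \<open>dist_opt\<close> is attained.
\<close>

definition dist_opt ::
  "('a \<Rightarrow> 'a \<Rightarrow> real) \<Rightarrow> 'a set \<Rightarrow> 'a::real_inner set \<Rightarrow> 'a \<Rightarrow> 'a \<Rightarrow> real \<Rightarrow> 'a \<Rightarrow> real" where
  "dist_opt ip K A c e z x = (INF y\<in>slice_maximizers K A c e z. ip_norm ip (x - y))"

text \<open>
  The supremum may be \<open>\<infinity>\<close>.  For \<open>z\<close> at least the optimal value it ranges over a
  nonempty set and is therefore nonnegative.
\<close>

definition Dist_level ::
  "('a \<Rightarrow> 'a \<Rightarrow> real) \<Rightarrow> 'a set \<Rightarrow> 'a::real_inner set \<Rightarrow> 'a \<Rightarrow> 'a \<Rightarrow> real \<Rightarrow> ereal" where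
  "Dist_level ip K A c e z =
     Sup {ereal (dist_opt ip K A c e z' x) |z' x. z' \<le> z \<and> x \<in> level K A c z'}"

definition algorithm_step ::
  "('a \<Rightarrow> 'a \<Rightarrow> real) \<Rightarrow> 'a set \<Rightarrow> 'a::real_inner set \<Rightarrow> 'a \<Rightarrow> 'a \<Rightarrow> 'a \<Rightarrow> 'a \<Rightarrow> bool" where
  "algorithm_step ip K A c e x x' \<longleftrightarrow>
     (\<exists>s g. is_supgradient ip (lambda_min K e) x s \<and>
            is_orth_projection ip (slice_space A c) s g \<and>
            x' = (if g = 0 then x
                  else x - (lambda_min K e x / (ip_norm ip g)\<^sup>2) *\<^sub>R g))"

text \<open>
  A sequence of iterates \<open>x\<close> produced by the algorithm from the input \<open>zopt\<close>, \<open>e\<close>, \<open>xbar\<close>,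
  for some choice of the supgradients.
\<close>

definition algorithm_run ::
  "('a \<Rightarrow> 'a \<Rightarrow> real) \<Rightarrow> 'a set \<Rightarrow> 'a::real_inner set \<Rightarrow> 'a \<Rightarrow> 'a \<Rightarrow> real \<Rightarrow> 'a \<Rightarrow> (nat \<Rightarrow> 'a) \<Rightarrow> bool"
  where
  "algorithm_run ip K A c e zopt xbar x \<longleftrightarrow>
     xbar \<in> A \<and> c \<bullet> xbar < c \<bullet> e \<and>
     x 0 = e + ((c \<bullet> e - zopt) / (c \<bullet> e - c \<bullet> xbar)) *\<^sub>R (xbar - e) \<and>
     (\<forall>k. algorithm_step ip K A c e (x k) (x (Suc k)))"

end

theory Submission
  imports Defs
begin

text \<open>
  Write \<open>\<mu> k = - lambda_min K e (x k)\<close> for the iterates.  They stay in the slice of the optimal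
  value, where the maximum of \<open>lambda_min\<close> is \<open>0\<close> and is attained exactly at the optimal solutions.
  Hence \<open>\<mu> k \<ge> 0\<close>, and the algorithm is Polyak's supgradient method with known optimal value
  \<open>0\<close>.  The radial projection turns \<open>\<mu> k\<close> into the relative objective gap
  \<open>\<mu> k / (1 + \<mu> k)\<close>, so a gap of at most \<open>\<epsilon>\<close> means \<open>\<mu> k \<le> \<delta>\<close> with
  \<open>\<delta> = \<epsilon> / (1 - \<epsilon>)\<close>.

  Every step reduces the squared distance to every optimal solution by at least
  \<open>(\<mu> k / M)\<^sup>2\<close>, because projected supgradients have norm at most \<open>M\<close>
  (\<open>step_progress\<close>).  On its own this gives a count proportional to the squared distance of the
  starting point from the optimal solutions, which may be much larger than \<open>Dist\<close>.  However,
  scaling about \<open>e\<close> carries maximizers in one slice to maximizers in another, so the distance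
  from \<open>x k\<close> to the optimal solutions is \<open>1 + \<mu> k\<close> times the distance from \<open>p k\<close>, a point of
  its own level set, to the maximizers in its slice (\<open>dist_opt_radial_proj\<close>).  As long as
  \<open>\<mu> k \<le> \<mu> 0\<close>, the latter is at most \<open>Dist\<close>.  While \<open>\<mu>\<close> stays above half of \<open>\<mu> k\<close>, each
  step uses up \<open>(\<mu> k / (2 M))\<^sup>2\<close> of the squared distance \<open>((1 + \<mu> k) Dist)\<^sup>2\<close>; so \<open>\<mu>\<close> is
  halved within \<open>(2 M Dist)\<^sup>2 (1 + 1 / \<mu> k)\<^sup>2\<close> steps (\<open>run_halves\<close>).

  It remains to add up these halving times until \<open>\<mu>\<close> is at most \<open>\<delta>\<close> (\<open>halving_time\<close>).
  Going backwards from the last phase, \<open>1 / \<mu>\<close> is at most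
  \<open>1 / \<delta>, 1 / (2 \<delta>), 1 / (4 \<delta>), \<dots>\<close>, so the squares contribute \<open>4/3 (1/\<delta>)\<^sup>2\<close>, the mixed
  terms \<open>4/\<delta>\<close>, and the constant terms the number of phases, which is at most
  \<open>log 2 (\<mu> 0 / \<delta>) + 1\<close>.  The two logarithms in the claimed bound add up to
  \<open>log 2 (\<mu> 0 / \<delta>)\<close>.
\<close>

section \<open>Halving sequences\<close>

text \<open>
  The number of steps is a geometric sum over the phases.  Closing the induction needs a bound
  that depends on the present value \<open>m\<close> of the sequence: the potential \<open>G m\<close>
  subtracts from the final bound the part \<open>1/3 (1/m)\<^sup>2 + 2/m\<close> of the geometric series that
  belongs to values larger than \<open>m\<close>.
\<close>

lemma halving_time:
  fixes \<mu> :: "nat \<Rightarrow> real" and C \<delta> :: real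
  assumes C: "0 \<le> C" and \<delta>: "0 < \<delta>"
    and halve: "\<And>k. \<delta> < \<mu> k \<Longrightarrow> \<mu> k \<le> \<mu> 0 \<Longrightarrow>
                  \<exists>j. \<mu> (k + j) \<le> \<mu> k / 2 \<and> real j \<le> C * (1 + 1 / \<mu> k)\<^sup>2"
    and start: "\<delta> < \<mu> 0"
  shows "\<exists>k. \<mu> k \<le> \<delta> \<and>
             real k \<le> C * (4 / 3 * (1 / \<delta>)\<^sup>2 + 4 * (1 / \<delta>) + log 2 (\<mu> 0 / \<delta>) + 1)"
proof -
  define G where "G m = 4 / 3 * (1 / \<delta>)\<^sup>2 - 1 / 3 * (1 / m)\<^sup>2 + 4 * (1 / \<delta>) - 2 * (1 / m)
                        + log 2 (m / \<delta>) + 1" for m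
  have G_bound: "(1 + 1 / m)\<^sup>2 \<le> G m" if "\<delta> < m" for m
  proof -
    have "1 / m \<le> 1 / \<delta>" "0 \<le> 1 / m"
      using that \<delta> by (simp_all add: frac_le)
    moreover from this have "(1 / m)\<^sup>2 \<le> (1 / \<delta>)\<^sup>2"
      by (rule power_mono)
    moreover have "0 \<le> log 2 (m / \<delta>)"
      using that \<delta> by simp
    ultimately show ?thesis
      unfolding G_def power2_sum by simp
  qed
  have G_step: "(1 + 1 / m)\<^sup>2 + G m' \<le> G m" if "\<delta> < m'" "m' \<le> m / 2" for m m'
  proof -
    have pos: "0 < m'" "0 < m"
      using that \<delta> by linarith+
    have inv: "2 * (1 / m) \<le> 1 / m'" "0 \<le> 2 * (1 / m)"
      using that pos by (simp_all add: field_simps)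
    have "(2 * (1 / m))\<^sup>2 \<le> (1 / m')\<^sup>2"
      using inv by (rule power_mono)
    then have "4 * (1 / m)\<^sup>2 \<le> (1 / m')\<^sup>2"
      by (simp only: power_mult_distrib) simp
    moreover have "log 2 (m' / \<delta>) + 1 \<le> log 2 (m / \<delta>)"
    proof -
      have "log 2 (m' / \<delta>) + 1 = log 2 (2 * (m' / \<delta>))"
        using pos \<delta> by (subst log_mult) auto
      also have "\<dots> \<le> log 2 (m / \<delta>)"
        using that pos \<delta> by (subst log_le_cancel_iff) (auto simp: field_simps)
      finally show ?thesis .
    qed
    ultimately show ?thesis
      using inv unfolding G_def power2_sum by simp
  qed
  have reach: "\<exists>j. \<mu> (k + j) \<le> \<delta> \<and> real j \<le> C * G (\<mu> k)"
    if "\<delta> < \<mu> k" "\<mu> k \<le> \<mu> 0" "\<mu> k \<le> 2 ^ n * \<delta>" for n k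
    \<comment> \<open>Every phase lowers the number \<open>n\<close> of halvings that would suffice to get from \<open>\<mu> k\<close> to \<open>\<delta>\<close>.\<close>
    using that
  proof (induction n arbitrary: k)
    case 0
    then show ?case by simp
  next
    case (Suc n)
    obtain j where j: "\<mu> (k + j) \<le> \<mu> k / 2" "real j \<le> C * (1 + 1 / \<mu> k)\<^sup>2"
      using halve Suc.prems by blast
    show ?case
    proof (cases "\<mu> (k + j) \<le> \<delta>")
      case True
      have "real j \<le> C * G (\<mu> k)"
        using j(2) mult_left_mono[OF G_bound[OF Suc.prems(1)] C] by linarith
      with True show ?thesis by blast
    next
      case False
      then have above: "\<delta> < \<mu> (k + j)" by simp
      have "\<mu> (k + j) \<le> \<mu> 0" "\<mu> (k + j) \<le> 2 ^ n * \<delta>"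
        using j(1) Suc.prems \<delta> by auto
      then obtain i where i: "\<mu> (k + j + i) \<le> \<delta>" "real i \<le> C * G (\<mu> (k + j))"
        using Suc.IH above by blast
      have "real (j + i) \<le> C * ((1 + 1 / \<mu> k)\<^sup>2 + G (\<mu> (k + j)))"
        using j(2) i(2) by (simp add: algebra_simps)
      also have "\<dots> \<le> C * G (\<mu> k)"
        using G_step[OF above j(1)] C by (rule mult_left_mono)
      finally show ?thesis
        using i(1) by (metis add.assoc)
    qed
  qed
  obtain n where "\<mu> 0 / \<delta> < 2 ^ n"
    using real_arch_pow[of 2 "\<mu> 0 / \<delta>"] by auto
  then have "\<mu> 0 \<le> 2 ^ n * \<delta>"
    using \<delta> by (simp add: field_simps)
  then obtain k where k: "\<mu> k \<le> \<delta>" "real k \<le> C * G (\<mu> 0)"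
    using reach[of 0 n] start by auto
  have "G (\<mu> 0) \<le> 4 / 3 * (1 / \<delta>)\<^sup>2 + 4 * (1 / \<delta>) + log 2 (\<mu> 0 / \<delta>) + 1"
  proof -
    have "0 \<le> 1 / 3 * (1 / \<mu> 0)\<^sup>2" "0 \<le> 2 * (1 / \<mu> 0)"
      using start \<delta> by simp_all
    then show ?thesis
      unfolding G_def by linarith
  qed
  then have "real k \<le> C * (4 / 3 * (1 / \<delta>)\<^sup>2 + 4 * (1 / \<delta>) + log 2 (\<mu> 0 / \<delta>) + 1)"
    using k(2) mult_left_mono[OF _ C] order_trans by blast
  with k(1) show ?thesis by blast
qed


section \<open>Inner products\<close>

lemma inner_product_symD:
  assumes "is_inner_product ip"
  shows "ip u v = ip v u"
  using assms unfolding is_inner_product_def by blast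

lemma inner_product_simps:
  assumes "is_inner_product ip"
  shows "ip (u + v) w = ip u w + ip v w" "ip w (u + v) = ip w u + ip w v"
    "ip (u - v) w = ip u w - ip v w" "ip w (u - v) = ip w u - ip w v"
    "ip (t *\<^sub>R u) w = t * ip u w" "ip w (t *\<^sub>R u) = t * ip w u"
    "ip (- u) w = - ip u w" "ip w (- u) = - ip w u"
    "ip 0 w = 0" "ip w 0 = 0"
  using assms unfolding is_inner_product_def
  by (auto simp: bilinear_ladd bilinear_radd bilinear_lsub bilinear_rsub bilinear_lmul
      bilinear_rmul bilinear_lneg bilinear_rneg bilinear_lzero bilinear_rzero)

lemma inner_product_nonneg:
  assumes "is_inner_product ip"
  shows "0 \<le> ip u u"
  using assms inner_product_simps(9)[OF assms] unfolding is_inner_product_def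
  by (metis order.refl less_imp_le)

lemma ip_norm_nonneg:
  assumes "is_inner_product ip"
  shows "0 \<le> ip_norm ip u"
  using inner_product_nonneg[OF assms] by (simp add: ip_norm_def)

lemma ip_norm_square:
  assumes "is_inner_product ip"
  shows "(ip_norm ip u)\<^sup>2 = ip u u"
  using inner_product_nonneg[OF assms] by (simp add: ip_norm_def)

lemma ip_norm_pos:
  assumes "is_inner_product ip" and "u \<noteq> 0"
  shows "0 < ip_norm ip u"
  using assms by (simp add: ip_norm_def is_inner_product_def)

lemma ip_norm_scaleR:
  assumes "is_inner_product ip"
  shows "ip_norm ip (t *\<^sub>R u) = \<bar>t\<bar> * ip_norm ip u"
proof -
  have "ip (t *\<^sub>R u) (t *\<^sub>R u) = t\<^sup>2 * ip u u"
    by (simp add: inner_product_simps[OF assms] power2_eq_square)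
  then show ?thesis
    by (simp add: ip_norm_def real_sqrt_mult)
qed

lemma ip_norm_minus:
  assumes "is_inner_product ip"
  shows "ip_norm ip (- u) = ip_norm ip u"
  by (simp add: ip_norm_def inner_product_simps[OF assms])

text \<open>
  The two norms are equivalent, since \<open>ip_norm ip\<close> has a positive minimum on the compact unit
  sphere.  This is what makes the Lipschitz constant with respect to \<open>ip_norm ip\<close> finite.
\<close>

lemma norm_le_ip_norm:
  fixes ip :: "'a::euclidean_space \<Rightarrow> 'a \<Rightarrow> real"
  assumes "is_inner_product ip"
  obtains B where "0 < B" "\<And>u. norm u \<le> B * ip_norm ip u"
proof -
  have bounded: "bounded_bilinear ip"
    using assms by (simp add: is_inner_product_def bilinear_conv_bounded_bilinear)
  then have cont: "continuous_on (sphere 0 1) (\<lambda>u. ip_norm ip u)"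
    unfolding ip_norm_def
    by (intro continuous_on_real_sqrt bounded_bilinear.continuous_on[OF bounded] continuous_on_id)
  obtain b :: 'a where "b \<in> Basis"
    using nonempty_Basis by blast
  then have "sphere (0::'a) 1 \<noteq> {}"
    by force
  then obtain w where w: "w \<in> sphere 0 1" "\<And>u. u \<in> sphere 0 1 \<Longrightarrow> ip_norm ip w \<le> ip_norm ip u"
    using continuous_attains_inf[OF compact_sphere _ cont] by blast
  have pos: "0 < ip_norm ip w"
    using w(1) by (intro ip_norm_pos[OF assms]) auto
  have "norm u \<le> (1 / ip_norm ip w) * ip_norm ip u" for u
  proof (cases "u = 0")
    case True
    then show ?thesis using ip_norm_nonneg[OF assms] pos by simp
  next
    case False
    have "ip_norm ip w \<le> ip_norm ip ((1 / norm u) *\<^sub>R u)"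
      using False by (intro w(2)) simp
    then show ?thesis
      using False pos by (simp add: ip_norm_scaleR[OF assms] field_simps)
  qed
  with pos show thesis
    using that[of "1 / ip_norm ip w"] by simp
qed


section \<open>The concave function of a solid cone\<close>

locale solid_cone =
  fixes K :: "'a::euclidean_space set" and e :: 'a
  assumes convex_cone: "convex_cone K" and closed: "closed K" and proper: "K \<noteq> UNIV"
    and e_interior: "e \<in> interior K"
begin

abbreviation lam :: "'a \<Rightarrow> real" where
  "lam \<equiv> lambda_min K e"

lemma cone_add: "x \<in> K \<Longrightarrow> y \<in> K \<Longrightarrow> x + y \<in> K"
  using convex_cone by (rule convex_cone_add)

lemma cone_scale: "x \<in> K \<Longrightarrow> 0 \<le> t \<Longrightarrow> t *\<^sub>R x \<in> K"
  using convex_cone by (simp add: convex_cone_def conic_def)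

lemma e_in_cone: "e \<in> K"
  using e_interior interior_subset by blast

text \<open>
  The quantitative form of \<open>e\<close> being an interior point, with \<open>B\<close> the reciprocal of the radius of
  a ball around \<open>e\<close> in \<open>K\<close>.  It bounds \<open>lambda_min\<close> from below.
\<close>

lemma e_absorbs:
  obtains B where "0 < B" "\<And>v. v + (B * norm v) *\<^sub>R e \<in> K"
proof -
  obtain r where r: "0 < r" "cball e r \<subseteq> K"
    using e_interior by (auto simp: mem_interior_cball)
  have "v + (1 / r * norm v) *\<^sub>R e \<in> K" for v
  proof (cases "v = 0")
    case True
    then show ?thesis using cone_scale[OF e_in_cone, of 0] by simp
  next
    case False
    have "e + (r / norm v) *\<^sub>R v \<in> K"
      using r False by (intro subsetD[OF r(2)]) (simp add: dist_norm)
    then have "(1 / r * norm v) *\<^sub>R (e + (r / norm v) *\<^sub>R v) \<in> K"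
      using r(1) by (intro cone_scale) auto
    then show ?thesis
      using r(1) False by (simp add: scaleR_add_right add.commute)
  qed
  with r(1) show thesis
    using that[of "1 / r"] by simp
qed

lemma minus_e_notin: "- e \<notin> K"
proof
  assume "- e \<in> K"
  obtain B where B: "0 < B" "\<And>v. v + (B * norm v) *\<^sub>R e \<in> K"
    using e_absorbs by blast
  have "v \<in> K" for v
    using cone_add[OF B(2)[of v] cone_scale[OF \<open>- e \<in> K\<close>, of "B * norm v"]] B(1) by simp
  with proper show False by blast
qed

text \<open>
  Along the line in direction \<open>e\<close>, membership in \<open>K\<close> is a closed lower half-line: it is
  downward closed since \<open>e \<in> K\<close>, and it is neither empty nor everything since \<open>e\<close> is interior
  and \<open>- e \<notin> K\<close>.  Its end point is \<open>lambda_min\<close>.  All further properties of \<open>lambda_min\<close>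
  come from this equivalence and the closure properties of \<open>K\<close>.
\<close>

lemma lambda_min_iff: "x - l *\<^sub>R e \<in> K \<longleftrightarrow> l \<le> lam x"
proof -
  define S where "S = {l. x - l *\<^sub>R e \<notin> K}"
  have up: "l' \<in> S" if "l \<in> S" "l \<le> l'" for l l'
  proof -
    have "x - l *\<^sub>R e \<in> K" if "x - l' *\<^sub>R e \<in> K"
      using cone_add[OF that cone_scale[OF e_in_cone, of "l' - l"]] \<open>l \<le> l'\<close>
      by (simp add: algebra_simps)
    with that show ?thesis by (auto simp: S_def)
  qed
  obtain B where B: "0 < B" "\<And>v. v + (B * norm v) *\<^sub>R e \<in> K"
    using e_absorbs by blast
  have "- (B * norm x) \<notin> S"
    using B(2)[of x] by (simp add: S_def)
  then have bdd: "bdd_below S"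
    using up by (intro bdd_belowI[of _ "- (B * norm x)"]) (meson linear)
  have "S \<noteq> {}"
  proof
    assume "S = {}"
    \<comment> \<open>If the whole line lay in \<open>K\<close>, then so would the limit \<open>- e\<close> of its rescaled points.\<close>
    have "- e + (1 / real (Suc n)) *\<^sub>R x \<in> K" for n
    proof -
      have "x - real (Suc n) *\<^sub>R e \<in> K"
        using \<open>S = {}\<close> by (auto simp: S_def)
      from cone_scale[OF this, of "1 / real (Suc n)"] show ?thesis
        by (simp add: scaleR_diff_right del: of_nat_Suc)
    qed
    moreover have "(\<lambda>n. - e + (1 / real (Suc n)) *\<^sub>R x) \<longlonglongrightarrow> - e + 0 *\<^sub>R x"
      by (intro tendsto_intros LIMSEQ_Suc lim_1_over_n)
    ultimately have "- e + 0 *\<^sub>R x \<in> K"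
      by (rule closed_sequentially[OF closed])
    then show False using minus_e_notin by simp
  qed
  have lam: "lam x = Inf S"
    by (simp add: lambda_min_def S_def)
  have "open S"
  proof -
    have "S = (\<lambda>l. x - l *\<^sub>R e) -` (- K)"
      by (auto simp: S_def)
    moreover have "open \<dots>"
      using closed by (intro open_vimage) (auto intro!: continuous_intros)
    ultimately show ?thesis by simp
  qed
  have "Inf S \<notin> S"
  proof
    assume "Inf S \<in> S"
    then obtain r where r: "0 < r" "ball (Inf S) r \<subseteq> S"
      using \<open>open S\<close> open_contains_ball by blast
    then have "Inf S - r / 2 \<in> S"
      by (intro subsetD[OF r(2)]) (simp add: dist_real_def)
    then show False using cInf_lower[OF _ bdd] r(1) by force
  qed
  show ?thesis
  proof
    assume "x - l *\<^sub>R e \<in> K"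
    then have "l \<notin> S" by (simp add: S_def)
    then show "l \<le> lam x"
      unfolding lam using up by (intro cInf_greatest[OF \<open>S \<noteq> {}\<close>]) (meson linear)
  next
    assume "l \<le> lam x"
    then have "l \<notin> S"
      using lam up \<open>Inf S \<notin> S\<close> by metis
    then show "x - l *\<^sub>R e \<in> K" by (simp add: S_def)
  qed
qed

lemma lambda_min_eqI: "(\<And>l. x - l *\<^sub>R e \<in> K \<longleftrightarrow> l \<le> m) \<Longrightarrow> lam x = m"
  using lambda_min_iff by (metis order.refl order.antisym)

lemma mem_cone_iff: "x \<in> K \<longleftrightarrow> 0 \<le> lam x"
  using lambda_min_iff[of x 0] by simp

lemma lambda_min_shift: "lam (x + s *\<^sub>R e) = lam x + s"
proof (rule lambda_min_eqI)
  fix l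
  have "x + s *\<^sub>R e - l *\<^sub>R e = x - (l - s) *\<^sub>R e"
    by (simp add: algebra_simps)
  then show "x + s *\<^sub>R e - l *\<^sub>R e \<in> K \<longleftrightarrow> l \<le> lam x + s"
    using lambda_min_iff[of x "l - s"] by (simp only: diff_le_eq)
qed

lemma lambda_min_scale:
  assumes "0 < t"
  shows "lam (t *\<^sub>R x) = t * lam x"
proof (rule lambda_min_eqI)
  fix l
  have "t *\<^sub>R x - l *\<^sub>R e = t *\<^sub>R (x - (l / t) *\<^sub>R e)"
    using assms by (simp add: scaleR_diff_right)
  moreover have "t *\<^sub>R y \<in> K \<longleftrightarrow> y \<in> K" for y
    using cone_scale[of y t] cone_scale[of "t *\<^sub>R y" "1 / t"] assms by auto
  ultimately show "t *\<^sub>R x - l *\<^sub>R e \<in> K \<longleftrightarrow> l \<le> t * lam x"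
    using lambda_min_iff[of x "l / t"] assms by (simp only: pos_divide_le_eq mult.commute)
qed

lemma lambda_min_zero: "lam 0 = 0"
  using lambda_min_scale[of 2 0] by simp

lemma lambda_min_e: "lam e = 1"
  using lambda_min_shift[of 0 1] lambda_min_zero by simp

text \<open>
  Given positive homogeneity, superadditivity is the same as concavity.  In this form it compares
  increments of \<open>lambda_min\<close> at any point with its values on directions.
\<close>

lemma lambda_min_add: "lam x + lam y \<le> lam (x + y)"
proof -
  have "(x - lam x *\<^sub>R e) + (y - lam y *\<^sub>R e) \<in> K"
    by (intro cone_add) (simp_all add: lambda_min_iff)
  then have "(x + y) - (lam x + lam y) *\<^sub>R e \<in> K"
    by (simp add: algebra_simps)
  then show ?thesis by (simp only: lambda_min_iff)
qed

lemma lambda_min_ray: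
  assumes "0 < t"
  shows "lam (e + t *\<^sub>R (x - e)) = 1 - t * (1 - lam x)"
proof -
  have "e + t *\<^sub>R (x - e) = t *\<^sub>R x + (1 - t) *\<^sub>R e"
    by (simp add: algebra_simps)
  then have "lam (e + t *\<^sub>R (x - e)) = t * lam x + (1 - t)"
    by (simp only: lambda_min_shift lambda_min_scale[OF assms])
  then show ?thesis by argo
qed

lemma lambda_min_lower:
  obtains B where "0 < B" "\<And>v. - lam v \<le> B * norm v"
proof -
  obtain B where B: "0 < B" "\<And>v. v + (B * norm v) *\<^sub>R e \<in> K"
    using e_absorbs by blast
  have "- lam v \<le> B * norm v" for v
    using B(2)[of v] lambda_min_shift[of v "B * norm v"] mem_cone_iff by force
  with B(1) that show thesis by blast
qed

end


section \<open>Slices of the feasible affine space\<close>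

locale conic_program = solid_cone K e for K :: "'a::euclidean_space set" and e +
  fixes A :: "'a set" and c :: 'a and ip :: "'a \<Rightarrow> 'a \<Rightarrow> real" and zopt :: real
  assumes affine: "affine A" and e_in: "e \<in> A"
    and not_orthogonal: "\<not> (\<forall>v\<in>direction A. orthogonal c v)"
    and optimum: "\<exists>y. optimal_solution K A c y"
    and zopt: "zopt = optimal_value K A c"
    and ip: "is_inner_product ip"
begin

lemma direction_add:
  assumes "v \<in> direction A" "y \<in> A"
  shows "y + t *\<^sub>R v \<in> A"
  using assms mem_affine_3_minus[OF affine] unfolding direction_def by blast

lemma descent_direction:
  obtains v where "v \<in> direction A" "c \<bullet> v < 0"
proof -
  obtain v where v: "v \<in> direction A" "c \<bullet> v \<noteq> 0"
    using not_orthogonal by (auto simp: orthogonal_def)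
  then have "- v \<in> direction A"
    unfolding direction_def by force
  with v that[of v] that[of "- v"] show thesis
    by (cases "c \<bullet> v < 0") auto
qed

text \<open>
  With \<open>t = 1 / (1 - lambda_min K e x)\<close> the point \<open>e + t *\<^sub>R (x - e)\<close> is the radial projection of
  \<open>x\<close>; other values of \<open>t\<close> move \<open>x\<close> between slices.
\<close>

lemma ray_in: "x \<in> A \<Longrightarrow> e + t *\<^sub>R (x - e) \<in> A"
  using direction_add[OF _ e_in, of "x - e"] e_in by (auto simp: direction_def)

lemma slice_nonempty: "\<exists>y. y \<in> affine_slice A c z"
proof -
  obtain v where v: "v \<in> direction A" "c \<bullet> v < 0"
    using descent_direction by blast
  have "e + ((z - c \<bullet> e) / (c \<bullet> v)) *\<^sub>R v \<in> affine_slice A c z"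
    using v direction_add[OF v(1) e_in] by (simp add: affine_slice_def inner_add_right)
  then show ?thesis by blast
qed

lemma slice_diff: "x \<in> affine_slice A c z \<Longrightarrow> y \<in> affine_slice A c z \<Longrightarrow> x - y \<in> slice_space A c"
  by (auto simp: slice_space_def direction_def)

lemma slice_add:
  assumes "v \<in> slice_space A c" "y \<in> affine_slice A c z"
  shows "y + t *\<^sub>R v \<in> affine_slice A c z"
proof -
  have "v \<in> direction A" "c \<bullet> v = 0"
    using assms(1) by (auto simp: slice_space_def direction_def affine_slice_def inner_diff_right)
  with assms(2) direction_add show ?thesis
    by (auto simp: affine_slice_def inner_add_right)
qed

lemma slice_space_minus: "v \<in> slice_space A c \<Longrightarrow> - v \<in> slice_space A c"
  unfolding slice_space_def direction_def by force

lemma zopt_le: "x \<in> A \<inter> K \<Longrightarrow> zopt \<le> c \<bullet> x"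
  and zopt_attained: "\<exists>y\<in>A \<inter> K. c \<bullet> y = zopt"
proof -
  obtain y where y: "y \<in> A \<inter> K" "\<And>x. x \<in> A \<inter> K \<Longrightarrow> c \<bullet> y \<le> c \<bullet> x"
    using optimum by (auto simp: optimal_solution_def)
  have "zopt = c \<bullet> y"
    unfolding zopt optimal_value_def using y by (intro cInf_eq_minimum) auto
  with y show "x \<in> A \<inter> K \<Longrightarrow> zopt \<le> c \<bullet> x" "\<exists>y\<in>A \<inter> K. c \<bullet> y = zopt"
    by auto
qed

text \<open>
  A point of \<open>A\<close> with positive \<open>lambda_min\<close> has room in every direction of \<open>A\<close>, in particular in
  one along which the objective decreases, so its objective value exceeds the optimal one.
\<close>

lemma lambda_min_nonpos:
  assumes "x \<in> A" "c \<bullet> x \<le> zopt"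
  shows "lam x \<le> 0"
proof (rule ccontr)
  assume "\<not> lam x \<le> 0"
  then have pos: "0 < lam x" by simp
  obtain v where v: "v \<in> direction A" "c \<bullet> v < 0"
    using descent_direction by blast
  define t where "t = lam x / (1 + \<bar>lam v\<bar>)"
  have t: "0 < t" using pos by (simp add: t_def)
  have "t * \<bar>lam v\<bar> \<le> lam x"
    using pos by (simp add: t_def field_simps)
  then have "0 \<le> lam x + lam (t *\<^sub>R v)"
    using lambda_min_scale[OF t, of v] abs_ge_minus_self[of "t * lam v"] t
    by (simp add: abs_mult)
  then have "x + t *\<^sub>R v \<in> A \<inter> K"
    using lambda_min_add[of x "t *\<^sub>R v"] direction_add[OF v(1) assms(1)]
    by (simp add: mem_cone_iff)
  then have "zopt \<le> c \<bullet> x + t * (c \<bullet> v)"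
    using zopt_le by (force simp: inner_add_right)
  with assms(2) mult_pos_neg[OF t v(2)] show False by linarith
qed

lemma zopt_less: "zopt < c \<bullet> e"
  using lambda_min_nonpos[OF e_in] lambda_min_e by force

text \<open>
  On the ray from \<open>e\<close> through a point, \<open>lambda_min\<close> is affine with value \<open>1\<close> at \<open>e\<close>.  Scaling
  about \<open>e\<close> therefore maps one slice onto another and preserves the order of the values of
  \<open>lambda_min\<close>.
\<close>

lemma maximizer_ray:
  assumes "0 < t" "y \<in> slice_maximizers K A c e z"
  shows "e + t *\<^sub>R (y - e) \<in> slice_maximizers K A c e (c \<bullet> e + t * (z - c \<bullet> e))"
proof -
  have y: "y \<in> A" "c \<bullet> y = z" and max: "\<And>x. x \<in> A \<Longrightarrow> c \<bullet> x = z \<Longrightarrow> lam x \<le> lam y"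
    using assms(2) by (auto simp: slice_maximizers_def affine_slice_def)
  have "lam x \<le> lam (e + t *\<^sub>R (y - e))" if x: "x \<in> A" "c \<bullet> x = c \<bullet> e + t * (z - c \<bullet> e)" for x
  proof -
    have "lam (e + (1 / t) *\<^sub>R (x - e)) \<le> lam y"
      using x assms(1) ray_in[OF x(1)]
      by (intro max) (auto simp: inner_add_right inner_diff_right)
    then have "1 - lam y \<le> (1 / t) * (1 - lam x)"
      using assms(1) by (simp only: lambda_min_ray zero_less_divide_1_iff)
    then have "t * (1 - lam y) \<le> 1 - lam x"
      using assms(1) by (simp add: field_simps)
    then show ?thesis
      by (simp only: lambda_min_ray[OF assms(1)])
  qed
  with y ray_in[OF y(1)] show ?thesis
    by (auto simp: slice_maximizers_def affine_slice_def inner_add_right inner_diff_right)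
qed

text \<open>
  In the slice of the optimal value \<open>lambda_min\<close> is nonpositive, and an optimal solution has the
  value \<open>0\<close>.  So the maximizers there are the optimal solutions.
\<close>

lemma maximizer_iff:
  "y \<in> slice_maximizers K A c e zopt \<longleftrightarrow> y \<in> affine_slice A c zopt \<and> 0 \<le> lam y"
proof -
  obtain w where w: "w \<in> affine_slice A c zopt" "0 \<le> lam w"
    using zopt_attained by (auto simp: affine_slice_def mem_cone_iff)
  have "lam x \<le> 0" if "x \<in> affine_slice A c zopt" for x
    using that lambda_min_nonpos by (auto simp: affine_slice_def)
  with w show ?thesis
    unfolding slice_maximizers_def by fastforce
qed


section \<open>The Lipschitz constant\<close>

text \<open>
  The Lipschitz constant on a slice bounds the rate of decrease of \<open>lambda_min\<close> in every direction
  \<open>v\<close> of \<open>\<L>\<close>, measured from the origin, which need not lie in the slice.  Far out on the line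
  \<open>y + t v\<close> within the slice, \<open>lambda_min\<close> differs from \<open>t\<close> times its value at \<open>v\<close> by a
  bounded amount; dividing by \<open>t\<close> leaves \<open>- lambda_min K e v \<le> M * ip_norm ip v\<close>.  Since superadditivity
  bounds the decrease from any point by the one from the origin, this
  makes \<open>M\<close> usable in all slices, whatever the slice \<open>z\<close> in which it is computed.
\<close>

lemma lipschitz_direction:
  assumes v: "v \<in> slice_space A c"
  shows "- lam v \<le> lipschitz_const ip K A c e z * ip_norm ip v"
proof (cases "v = 0")
  case True
  then show ?thesis
    by (simp add: lambda_min_zero ip_norm_def inner_product_simps[OF ip])
next
  case False
  define Q where "Q = {\<bar>lam x - lam y\<bar> / ip_norm ip (x - y) |x y.
    x \<in> affine_slice A c z \<and> y \<in> affine_slice A c z \<and> x \<noteq> y}"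
  define M where "M = lipschitz_const ip K A c e z"
  have M: "M = Sup Q"
    using v False by (auto simp: M_def lipschitz_const_def Q_def)
  obtain B where B: "0 < B" "\<And>v. - lam v \<le> B * norm v"
    using lambda_min_lower by blast
  obtain B' where B': "0 < B'" "\<And>u. norm u \<le> B' * ip_norm ip u"
    using norm_le_ip_norm[OF ip] by blast
  have "\<bar>lam x - lam y\<bar> / ip_norm ip (x - y) \<le> B * B'" if "x \<noteq> y" for x y
  proof -
    have "\<bar>lam x - lam y\<bar> \<le> B * norm (x - y)"
      using B(2)[of "x - y"] B(2)[of "y - x"] lambda_min_add[of x "y - x"]
        lambda_min_add[of y "x - y"] by (simp add: norm_minus_commute abs_le_iff)
    also have "\<dots> \<le> B * (B' * ip_norm ip (x - y))"
      using B B' by (intro mult_left_mono) auto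
    finally show ?thesis
      using ip_norm_pos[OF ip, of "x - y"] that by (simp add: field_simps)
  qed
  then have bdd: "bdd_above Q"
    unfolding Q_def bdd_above_def by blast
  obtain y where y: "y \<in> affine_slice A c z"
    using slice_nonempty by blast
  define N where "N = ip_norm ip v"
  have N: "0 < N" using ip_norm_pos[OF ip False] by (simp add: N_def)
  \<comment> \<open>The right-hand side does not depend on \<open>t\<close>, which forces the factor on the left to be nonpositive.\<close>
  have far: "t * (- lam v - M * N) \<le> - lam y - lam (- y)" if t: "0 < t" for t
  proof -
    have "\<bar>lam y - lam (y + t *\<^sub>R v)\<bar> / ip_norm ip (y - (y + t *\<^sub>R v)) \<le> M"
    proof -
      have "y \<noteq> y + t *\<^sub>R v"
        using False t by simp
      then show ?thesis
        unfolding M using y slice_add[OF v y]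
        by (intro cSup_upper[OF _ bdd]) (unfold Q_def, blast)
    qed
    moreover have "ip_norm ip (y - (y + t *\<^sub>R v)) = t * N"
      using t by (simp add: N_def ip_norm_minus[OF ip] ip_norm_scaleR[OF ip])
    ultimately have "lam y - lam (y + t *\<^sub>R v) \<le> M * (t * N)"
      using t N by (simp add: pos_divide_le_eq)
    moreover have "lam (y + t *\<^sub>R v) + lam (- y) \<le> t * lam v"
      using lambda_min_add[of "y + t *\<^sub>R v" "- y"] lambda_min_scale[OF t] by simp
    ultimately show ?thesis by (simp add: algebra_simps)
  qed
  have "- lam v - M * N \<le> 0"
  proof (rule ccontr)
    assume "\<not> - lam v - M * N \<le> 0"
    then obtain n where "max 0 (- lam y - lam (- y)) < real n * (- lam v - M * N)"
      using reals_Archimedean3[of "- lam v - M * N"] by (meson not_le)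
    then obtain t where t: "max 0 (- lam y - lam (- y)) < t * (- lam v - M * N)"
      by blast
    then have "0 < t"
      using \<open>\<not> - lam v - M * N \<le> 0\<close> by (simp add: zero_less_mult_iff)
    with far t show False by fastforce
  qed
  then show ?thesis by (simp add: M_def N_def)
qed


section \<open>Progress of one step\<close>

lemma step_in_slice:
  assumes "algorithm_step ip K A c e x x'" "x \<in> affine_slice A c z"
  shows "x' \<in> affine_slice A c z"
proof -
  obtain s g where g: "is_orth_projection ip (slice_space A c) s g"
    and x': "x' = (if g = 0 then x else x - (lam x / (ip_norm ip g)\<^sup>2) *\<^sub>R g)"
    using assms(1) unfolding algorithm_step_def by blast
  have "g \<in> slice_space A c"
    using g by (simp add: is_orth_projection_def)
  from slice_add[OF this assms(2), of "- (lam x / (ip_norm ip g)\<^sup>2)"] show ?thesis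
    using x' assms(2) by simp
qed

text \<open>
  Polyak's estimate.  With \<open>a = - lambda_min K e x / N\<^sup>2\<close> and \<open>N\<close> the norm of the projected supgradient \<open>g\<close>,
  the step is \<open>a *\<^sub>R g\<close>, and the supgradient inequality gives \<open>ip g (y - x) \<ge> - lambda_min K e x\<close>
  for any optimal solution \<open>y\<close>.  Expanding the square shows a decrease of at least
  \<open>(lambda_min K e x)\<^sup>2 / N\<^sup>2\<close>, and \<open>N \<le> M\<close> because \<open>lambda_min\<close> falls at least at rate \<open>N\<close> along
  \<open>- g\<close>.  Multiplying by \<open>M\<^sup>2\<close> gives a form that also covers \<open>g = 0\<close>, where \<open>x\<close> is already
  optimal.
\<close>

lemma step_progress:
  assumes step: "algorithm_step ip K A c e x x'" and x: "x \<in> affine_slice A c zopt"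
    and y: "y \<in> slice_maximizers K A c e zopt"
  shows "(lam x)\<^sup>2 \<le> (lipschitz_const ip K A c e z)\<^sup>2
           * ((ip_norm ip (x - y))\<^sup>2 - (ip_norm ip (x' - y))\<^sup>2)"
proof -
  define M where "M = lipschitz_const ip K A c e z"
  obtain s g where sup: "is_supgradient ip lam x s"
    and proj: "is_orth_projection ip (slice_space A c) s g"
    and x': "x' = (if g = 0 then x else x - (lam x / (ip_norm ip g)\<^sup>2) *\<^sub>R g)"
    using step unfolding algorithm_step_def by blast
  have gL: "g \<in> slice_space A c"
    using proj by (simp add: is_orth_projection_def)
  have sup': "lam (x + v) \<le> lam x + ip g v" if "v \<in> slice_space A c" for v
  proof -
    have "ip s v = ip g v"
      using proj that by (simp add: is_orth_projection_def inner_product_simps[OF ip])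
    then show ?thesis
      using sup by (metis is_supgradient_def)
  qed
  have yA: "y \<in> affine_slice A c zopt" and y0: "0 \<le> lam y"
    using y by (simp_all add: maximizer_iff)
  have x0: "lam x \<le> 0"
    using x lambda_min_nonpos by (auto simp: affine_slice_def)
  have angle: "- lam x \<le> ip g (y - x)"
    using sup'[OF slice_diff[OF yA x]] y0 by simp
  show ?thesis
  proof (cases "g = 0")
    case True
    then show ?thesis
      using angle x0 x' by (simp add: inner_product_simps[OF ip])
  next
    case False
    define N where "N = ip_norm ip g"
    have N: "0 < N" "N\<^sup>2 = ip g g"
      using ip_norm_pos[OF ip False] ip_norm_square[OF ip] by (simp_all add: N_def)
    have "N\<^sup>2 \<le> - lam (- g)"
      using sup'[OF slice_space_minus[OF gL]] lambda_min_add[of x "- g"] N(2)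
      by (simp add: inner_product_simps[OF ip])
    also have "\<dots> \<le> M * N"
      using lipschitz_direction[OF slice_space_minus[OF gL], of z]
      by (simp add: M_def N_def ip_norm_minus[OF ip])
    finally have "N \<le> M"
      using N(1) by (simp add: power2_eq_square)
    define a where "a = - lam x / N\<^sup>2"
    have a: "0 \<le> a" "a * N\<^sup>2 = - lam x"
      using x0 N(1) by (simp_all add: a_def divide_nonpos_pos)
    have eq: "x' - y = a *\<^sub>R g - (y - x)"
      using x' False by (simp add: a_def N_def)
    have sq: "(ip_norm ip (x' - y))\<^sup>2 = a\<^sup>2 * N\<^sup>2 - 2 * (a * ip g (y - x)) + (ip_norm ip (x - y))\<^sup>2"
      unfolding eq ip_norm_square[OF ip] N(2)
      by (simp add: inner_product_simps[OF ip] inner_product_symD[OF ip, of x g]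
          inner_product_symD[OF ip, of x y] inner_product_symD[OF ip, of y g] power2_eq_square algebra_simps)
    have "a\<^sup>2 * N\<^sup>2 = a * (- lam x)"
      using a(2) by (simp add: power2_eq_square mult.assoc)
    then have decr: "a * (- lam x) \<le> (ip_norm ip (x - y))\<^sup>2 - (ip_norm ip (x' - y))\<^sup>2"
      using sq mult_left_mono[OF angle a(1)] by linarith
    have "(lam x)\<^sup>2 = N\<^sup>2 * (a * (- lam x))"
      using a(2) by (metis mult.assoc mult.commute power2_eq_square power2_minus)
    also have "\<dots> \<le> M\<^sup>2 * (a * (- lam x))"
      using \<open>N \<le> M\<close> N(1) x0
      by (intro mult_right_mono power_mono mult_nonneg_nonneg[OF a(1)]) auto
    also have "\<dots> \<le> M\<^sup>2 * ((ip_norm ip (x - y))\<^sup>2 - (ip_norm ip (x' - y))\<^sup>2)"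
      using decr by (intro mult_left_mono) auto
    finally show ?thesis by (simp add: M_def)
  qed
qed

lemma lipschitz_nonneg: "0 \<le> lipschitz_const ip K A c e z"
proof (cases "slice_space A c = {0}")
  case True
  then show ?thesis by (simp add: lipschitz_const_def)
next
  case False
  obtain y where "y \<in> affine_slice A c z"
    using slice_nonempty by blast
  then have "0 \<in> slice_space A c"
    using slice_diff by fastforce
  with False obtain v where v: "v \<in> slice_space A c" "v \<noteq> 0"
    by blast
  have "0 \<le> - lam v - lam (- v)"
    using lambda_min_add[of v "- v"] lambda_min_zero by simp
  also have "\<dots> \<le> 2 * (lipschitz_const ip K A c e z * ip_norm ip v)"
    using lipschitz_direction[OF v(1), of z]
      lipschitz_direction[OF slice_space_minus[OF v(1)], of z]
    by (simp add: ip_norm_minus[OF ip])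
  finally show ?thesis
    using ip_norm_pos[OF ip v(2)] by (simp add: zero_le_mult_iff)
qed


section \<open>Radial projections and distances\<close>

lemma radial_proj_value:
  assumes "x \<in> affine_slice A c zopt"
  shows "c \<bullet> radial_proj K e x = c \<bullet> e - (c \<bullet> e - zopt) / (1 - lam x)"
  using assms
  by (simp add: radial_proj_def affine_slice_def inner_add_right inner_diff_right diff_divide_distrib)

text \<open>
  The radial projection sends the defect \<open>\<mu> = - lambda_min K e x\<close> to the relative gap
  \<open>\<mu> / (1 + \<mu>)\<close>, an increasing function of \<open>\<mu>\<close>.
\<close>

lemma radial_proj_gap:
  assumes "x \<in> affine_slice A c zopt"
  shows "(c \<bullet> radial_proj K e x - zopt) / (c \<bullet> e - zopt) = - lam x / (1 - lam x)"
proof -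
  have "lam x \<le> 0"
    using assms lambda_min_nonpos by (auto simp: affine_slice_def)
  then show ?thesis
    using zopt_less by (simp add: radial_proj_value[OF assms] divide_simps) (simp add: algebra_simps)
qed

lemma radial_proj_level:
  assumes "x \<in> affine_slice A c zopt"
  shows "radial_proj K e x \<in> level K A c (c \<bullet> radial_proj K e x)"
proof -
  have x: "x \<in> A" "lam x \<le> 0"
    using assms lambda_min_nonpos by (auto simp: affine_slice_def)
  then have "lam (radial_proj K e x) = 0"
    by (simp only: radial_proj_def lambda_min_ray zero_less_divide_1_iff) simp
  moreover have "radial_proj K e x \<in> A"
    using ray_in[OF x(1)] by (simp add: radial_proj_def)
  ultimately show ?thesis
    by (simp add: level_def affine_slice_def mem_cone_iff)
qed

text \<open>
  Scaling about \<open>e\<close> by \<open>t = 1 - lambda_min K e x\<close> takes the radial projection of \<open>x\<close> back to \<open>x\<close> and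
  the maximizers in the slice of the projection to optimal solutions.  Every distance to be
  bounded from below is thus \<open>1 / t\<close> times a distance from \<open>x\<close> to an optimal solution.
\<close>

lemma dist_opt_radial_proj:
  assumes x: "x \<in> affine_slice A c zopt"
    and b: "\<And>y. y \<in> slice_maximizers K A c e zopt \<Longrightarrow> b \<le> ip_norm ip (x - y)"
  shows "b / (1 - lam x) \<le> dist_opt ip K A c e (c \<bullet> radial_proj K e x) (radial_proj K e x)"
proof -
  define p where "p = radial_proj K e x"
  define t where "t = 1 - lam x"
  have t: "0 < t"
    using x lambda_min_nonpos by (force simp: affine_slice_def t_def)
  have cp: "c \<bullet> p = c \<bullet> e + (1 / t) * (zopt - c \<bullet> e)"
    using radial_proj_value[OF x] by (simp add: p_def t_def diff_divide_distrib)
  have zopt_p: "c \<bullet> e + t * (c \<bullet> p - c \<bullet> e) = zopt"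
    using t by (simp add: cp)
  have x_p: "x = e + t *\<^sub>R (p - e)"
    using t by (simp add: p_def radial_proj_def t_def[symmetric])
  obtain w where "w \<in> slice_maximizers K A c e zopt"
    using zopt_attained by (auto simp: maximizer_iff affine_slice_def mem_cone_iff)
  then have "slice_maximizers K A c e (c \<bullet> p) \<noteq> {}"
    using maximizer_ray[of "1 / t" w zopt] t unfolding cp by auto
  moreover have "b / t \<le> ip_norm ip (p - y)" if "y \<in> slice_maximizers K A c e (c \<bullet> p)" for y
  proof -
    have "e + t *\<^sub>R (y - e) \<in> slice_maximizers K A c e zopt"
      using maximizer_ray[OF t that] by (simp only: zopt_p)
    then have "b \<le> ip_norm ip (x - (e + t *\<^sub>R (y - e)))"
      by (rule b)
    also have "x - (e + t *\<^sub>R (y - e)) = t *\<^sub>R (p - y)"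
      by (subst x_p) (simp add: algebra_simps)
    finally show ?thesis
      using t by (simp add: ip_norm_scaleR[OF ip] pos_divide_le_eq mult.commute)
  qed
  ultimately show ?thesis
    unfolding dist_opt_def p_def[symmetric] t_def[symmetric] by (rule cINF_greatest)
qed


section \<open>Runs of the algorithm\<close>

lemma run_in_slice:
  assumes "algorithm_run ip K A c e zopt xbar x"
  shows "x k \<in> affine_slice A c zopt"
proof (induction k)
  case 0
  have "xbar \<in> A" "c \<bullet> xbar < c \<bullet> e"
    and x0: "x 0 = e + ((c \<bullet> e - zopt) / (c \<bullet> e - c \<bullet> xbar)) *\<^sub>R (xbar - e)"
    using assms by (simp_all add: algorithm_run_def)
  moreover from this have "c \<bullet> x 0 = zopt"
    by (simp add: inner_add_right inner_diff_right divide_simps) (simp add: algebra_simps)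
  ultimately show ?case
    using ray_in by (simp add: affine_slice_def)
next
  case (Suc k)
  then show ?case
    using assms step_in_slice by (auto simp: algorithm_run_def)
qed

text \<open>
  One halving phase.  If \<open>- lambda_min\<close> stayed above \<open>m / 2\<close> for \<open>n\<close> steps from \<open>x k\<close>, then by
  \<open>step_progress\<close> the squared distance from \<open>x k\<close> to each optimal solution would be at least
  \<open>n (m / (2 M))\<^sup>2\<close>.  The distance of the radial projection from the maximizers in its slice would
  then exceed \<open>D\<close> as soon as \<open>n\<close> is larger than the claimed bound \<open>T\<close>.
  Positivity of the Lipschitz constant comes along, since a non-optimal iterate makes progress.
\<close>

lemma run_halves:
  assumes run: "algorithm_run ip K A c e zopt xbar x"
    and pos: "lam (x k) < 0"
    and D: "dist_opt ip K A c e (c \<bullet> radial_proj K e (x k)) (radial_proj K e (x k)) \<le> D"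
  shows "0 < lipschitz_const ip K A c e z"
    and "\<exists>j. - lam (x (k + j)) \<le> - lam (x k) / 2 \<and>
             real j \<le> (2 * lipschitz_const ip K A c e z * D)\<^sup>2 * (1 + 1 / (- lam (x k)))\<^sup>2"
proof -
  define M where "M = lipschitz_const ip K A c e z"
  define m where "m = - lam (x k)"
  define T where "T = (2 * M * D)\<^sup>2 * (1 + 1 / m)\<^sup>2"
  have m: "0 < m" using pos by (simp add: m_def)
  have progress: "(lam (x i))\<^sup>2
      \<le> M\<^sup>2 * ((ip_norm ip (x i - y))\<^sup>2 - (ip_norm ip (x (Suc i) - y))\<^sup>2)"
    if "y \<in> slice_maximizers K A c e zopt" for i y
    unfolding M_def using run run_in_slice[OF run] that
    by (intro step_progress) (auto simp: algorithm_run_def)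
  obtain w where w: "w \<in> slice_maximizers K A c e zopt"
    using zopt_attained by (auto simp: maximizer_iff affine_slice_def mem_cone_iff)
  have "M \<noteq> 0"
    using progress[OF w, of k] pos by auto
  then have M: "0 < M"
    using lipschitz_nonneg[of z] by (simp add: M_def)
  then show "0 < lipschitz_const ip K A c e z" by (simp add: M_def)
  have "\<exists>j. - lam (x (k + j)) \<le> m / 2 \<and> real j \<le> T"
  proof (rule ccontr)
    assume contra: "\<not> ?thesis"
    \<comment> \<open>The offsets \<open>j < n\<close> are those with \<open>j \<le> T\<close>, where no halving has happened; but \<open>n > T\<close>.\<close>
    define n where "n = nat \<lfloor>T\<rfloor> + 1"
    have n: "T < real n"
      unfolding n_def by linarith
    have "0 \<le> T" by (simp add: T_def)
    then have large: "m / 2 < - lam (x (k + j))" if "j < n" for j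
    proof -
      have "real j \<le> T"
        using that \<open>0 \<le> T\<close> unfolding n_def by linarith
      with contra show ?thesis by force
    qed
    have sums: "real i * (m / 2)\<^sup>2
        \<le> M\<^sup>2 * ((ip_norm ip (x k - y))\<^sup>2 - (ip_norm ip (x (k + i) - y))\<^sup>2)"
      if "i \<le> n" "y \<in> slice_maximizers K A c e zopt" for i y
      using that(1)
    proof (induction i)
      case 0
      then show ?case by simp
    next
      case (Suc i)
      have "(m / 2)\<^sup>2 \<le> (- lam (x (k + i)))\<^sup>2"
        using large[of i] Suc.prems m by (intro power_mono) auto
      then show ?case
        using Suc progress[OF that(2), of "k + i"] by (simp add: algebra_simps)
    qed
    have "sqrt (real n) * m / (2 * M) \<le> ip_norm ip (x k - y)"
      if "y \<in> slice_maximizers K A c e zopt" for y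
    proof -
      have "(sqrt (real n) * (m / 2))\<^sup>2 = real n * (m / 2)\<^sup>2"
        by (subst power_mult_distrib) simp
      also have "\<dots> \<le> M\<^sup>2 * ((ip_norm ip (x k - y))\<^sup>2 - (ip_norm ip (x (k + n) - y))\<^sup>2)"
        using that by (intro sums) auto
      also have "\<dots> \<le> (M * ip_norm ip (x k - y))\<^sup>2"
        by (simp add: power_mult_distrib mult_left_mono)
      finally have "sqrt (real n) * (m / 2) \<le> M * ip_norm ip (x k - y)"
        by (rule power2_le_imp_le) (use M ip_norm_nonneg[OF ip] in simp)
      then show ?thesis
        using M by (simp add: field_simps)
    qed
    then have "sqrt (real n) * m / (2 * M) / (1 - lam (x k)) \<le> D"
      using dist_opt_radial_proj[OF run_in_slice[OF run]] D order_trans by blast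
    moreover have "1 - lam (x k) = 1 + m"
      by (simp add: m_def)
    moreover have "0 < 1 + m" "0 < 2 * M"
      using M m by simp_all
    ultimately have "sqrt (real n) * m \<le> D * (1 + m) * (2 * M)"
      by (simp only: pos_divide_le_eq)
    then have "sqrt (real n) \<le> 2 * M * D * (1 + 1 / m)"
      using m by (simp add: field_simps)
    then have "(sqrt (real n))\<^sup>2 \<le> (2 * M * D * (1 + 1 / m))\<^sup>2"
      by (rule power_mono) simp
    then show False
      using n by (simp add: T_def power_mult_distrib)
  qed
  then show "\<exists>j. - lam (x (k + j)) \<le> - lam (x k) / 2 \<and>
      real j \<le> (2 * lipschitz_const ip K A c e z * D)\<^sup>2 * (1 + 1 / (- lam (x k)))\<^sup>2"
    by (simp only: M_def m_def T_def)
qed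

end


section \<open>The iteration bound\<close>

theorem theorem3p7:
  fixes K A :: "'a::euclidean_space set"
    and c e xbar :: 'a
    and ip :: "'a \<Rightarrow> 'a \<Rightarrow> real"
    and x p :: "nat \<Rightarrow> 'a"
    and zopt z M r0 \<epsilon> :: real
    and l :: nat
  assumes "convex_cone K" and "closed K" and "K \<noteq> UNIV" and "interior K \<noteq> {}"
    and "affine A"
    and "\<not> (\<forall>v\<in>direction A. orthogonal c v)"
    and "\<exists>y. optimal_solution K A c y"
    and "zopt = optimal_value K A c"
    and "e \<in> A \<inter> interior K"
    and "is_inner_product ip"
    and "M = lipschitz_const ip K A c e z"
    and "algorithm_run ip K A c e zopt xbar x"
    and "\<And>k. p k = radial_proj K e (x k)"
    and "r0 = (c \<bullet> p 0 - zopt) / (c \<bullet> e - zopt)"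
    and "0 < \<epsilon>" and "\<epsilon> < r0"
    and "ereal (real l) \<ge>
           (2 * ereal M * Dist_level ip K A c e (c \<bullet> p 0))\<^sup>2 *
           ereal (4 / 3 * ((1 - \<epsilon>) / \<epsilon>)\<^sup>2 + 4 * ((1 - \<epsilon>) / \<epsilon>)
                  + log 2 (r0 / \<epsilon>) + log 2 ((1 - \<epsilon>) / (1 - r0)) + 1)"
  shows "(MIN k\<in>{..l}. (c \<bullet> p k - zopt) / (c \<bullet> e - zopt)) \<le> \<epsilon>"
proof -
  interpret conic_program K e A c ip zopt
    using assms by unfold_locales auto
  define \<mu> where "\<mu> k = - lam (x k)" for k
  define \<delta> where "\<delta> = \<epsilon> / (1 - \<epsilon>)"
  define D where "D = Dist_level ip K A c e (c \<bullet> p 0)"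
  define F where "F = 4 / 3 * ((1 - \<epsilon>) / \<epsilon>)\<^sup>2 + 4 * ((1 - \<epsilon>) / \<epsilon>)
                  + log 2 (r0 / \<epsilon>) + log 2 ((1 - \<epsilon>) / (1 - r0)) + 1"
  note run = assms(12) and p = assms(13)
  have slice: "x k \<in> affine_slice A c zopt" for k
    by (rule run_in_slice[OF run])
  have \<mu>_nonneg: "0 \<le> \<mu> k" for k
    using slice lambda_min_nonpos by (auto simp: affine_slice_def \<mu>_def)
  have gap: "(c \<bullet> p k - zopt) / (c \<bullet> e - zopt) = \<mu> k / (1 + \<mu> k)" for k
    using radial_proj_gap[OF slice] by (simp add: p \<mu>_def)
  have r0: "r0 = \<mu> 0 / (1 + \<mu> 0)"
    using gap assms(14) by simp
  have "r0 < 1" and \<mu>0: "\<mu> 0 = r0 / (1 - r0)"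
    using \<mu>_nonneg[of 0] by (auto simp: r0 field_simps)
  have \<epsilon>: "0 < \<epsilon>" "\<epsilon> < r0" "\<epsilon> < 1"
    using assms(15,16) \<open>r0 < 1\<close> by auto
  have \<delta>: "0 < \<delta>" "\<delta> < \<mu> 0"
    using \<epsilon> \<open>r0 < 1\<close> by (simp_all add: \<delta>_def \<mu>0 frac_less)
  have F: "F = 4 / 3 * (1 / \<delta>)\<^sup>2 + 4 * (1 / \<delta>) + log 2 (\<mu> 0 / \<delta>) + 1"
  proof -
    have "\<mu> 0 / \<delta> = r0 / \<epsilon> * ((1 - \<epsilon>) / (1 - r0))"
      by (simp add: \<mu>0 \<delta>_def)
    then have "log 2 (\<mu> 0 / \<delta>) = log 2 (r0 / \<epsilon>) + log 2 ((1 - \<epsilon>) / (1 - r0))"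
      using \<epsilon> \<open>r0 < 1\<close> by (simp only:) (subst log_mult, auto)
    then show ?thesis
      by (simp add: F_def \<delta>_def)
  qed
  have "0 \<le> log 2 (\<mu> 0 / \<delta>)"
    using \<delta> by simp
  then have F_pos: "0 < F"
    using \<delta> unfolding F by (intro add_nonneg_pos add_nonneg_nonneg) auto
  have Dist: "ereal (dist_opt ip K A c e (c \<bullet> p k) (p k)) \<le> D" if "\<mu> k \<le> \<mu> 0" for k
  proof -
    have "(c \<bullet> p k - zopt) / (c \<bullet> e - zopt) \<le> (c \<bullet> p 0 - zopt) / (c \<bullet> e - zopt)"
      unfolding gap using that \<mu>_nonneg[of k] \<mu>_nonneg[of 0] by (simp add: field_simps)
    then have "c \<bullet> p k \<le> c \<bullet> p 0"
      using zopt_less by (simp add: divide_le_cancel)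
    then show ?thesis
      unfolding D_def Dist_level_def using radial_proj_level[OF slice, of k]
      by (intro Sup_upper) (auto simp: p)
  qed
  have "lam (x 0) < 0"
    using \<delta> by (simp add: \<mu>_def)
  then have M: "0 < M"
    using run_halves(1)[OF run _ order.refl, of 0 z] assms(11) by simp
  have bound: "(2 * ereal M * D)\<^sup>2 * ereal F \<le> ereal (real l)"
    using assms(17) by (simp only: F_def D_def)
  \<comment> \<open>An infinite \<open>Dist\<close> would make the required number of steps infinite, because \<open>M\<close> and \<open>F\<close> are positive.\<close>
  obtain d where d: "D = ereal d"
  proof (cases D)
    case PInf
    then show thesis
      using bound M F_pos by (simp add: power2_eq_square)
  next
    case MInf
    then show thesis using Dist[of 0] by simp
  qed (rule that)
  have l: "(2 * M * d)\<^sup>2 * F \<le> real l"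
    using bound by (simp add: d power2_eq_square numeral_eq_ereal)
  have "\<exists>k. \<mu> k \<le> \<delta> \<and> real k \<le> (2 * M * d)\<^sup>2 * F"
    unfolding F
  proof (rule halving_time)
    fix k
    assume "\<delta> < \<mu> k" "\<mu> k \<le> \<mu> 0"
    then show "\<exists>j. \<mu> (k + j) \<le> \<mu> k / 2 \<and> real j \<le> (2 * M * d)\<^sup>2 * (1 + 1 / \<mu> k)\<^sup>2"
      using run_halves(2)[OF run, of k d z] Dist[of k] \<delta>
      by (simp add: \<mu>_def d p assms(11))
  qed (use \<delta> in auto)
  then obtain k where k: "\<mu> k \<le> \<delta>" "real k \<le> (2 * M * d)\<^sup>2 * F"
    by blast
  then have "k \<le> l" using l by linarith
  then have "(MIN k\<in>{..l}. (c \<bullet> p k - zopt) / (c \<bullet> e - zopt)) \<le> (c \<bullet> p k - zopt) / (c \<bullet> e - zopt)"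
    by (intro Min_le) auto
  also have "\<dots> \<le> \<epsilon>"
    unfolding gap using k(1) \<mu>_nonneg[of k] \<epsilon> by (simp add: \<delta>_def field_simps)
  finally show ?thesis .
qed

end
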